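(* Let $G$ be a digraph and let $W$ be a walk cover of $G$, and let $K$ be the set of lengths $k$ such that $W$ contains a walk of length $k$. Then the directed line graph $L(G)$ has a walk cover all of whose walks have lengths in $K+1=\{k+1\mid k\in K\}$.
   Context: Walks may repeat vertices and edges; the length of a walk is its number of edges (a single vertex is a walk of length $0$). A walk cover of a digraph $G$ is a set $W$ of walks such that for every ordered pair of vertices $(u,v)$, where $u=v$ is allowed, $W$ contains exactly one walk from $u$ to $v$. The directed line graph $L(G)$ of $G=(V,E)$ has vertex set $E$ and a directed edge from $(u,v)$ to $(v,w)$ for every pair of edges $(u,v),(v,w)\in E$. *)

theory Defs
  imports "Graph_Theory.Pair_Digraph" "Graph_Theory.Vertex_Walk"
begin

text \<open>
  Digraphs have at most one arc from one vertex to another, loops are allowed, and nothing is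
  assumed to be finite. Since there are no parallel arcs, a walk is determined by its nonempty
  vertex list.
\<close>

definition walk_cover :: "'a pair_pre_digraph \<Rightarrow> 'a vwalk set \<Rightarrow> bool" where
  "walk_cover G W \<longleftrightarrow>
     (\<forall>p\<in>W. vwalk p (with_proj G)) \<and>
     (\<forall>u\<in>pverts G. \<forall>v\<in>pverts G. \<exists>!p. p \<in> W \<and> hd p = u \<and> last p = v)"

definition line_digraph :: "'a pair_pre_digraph \<Rightarrow> ('a \<times> 'a) pair_pre_digraph" where
  "line_digraph G =
     \<lparr> pverts = parcs G,
       parcs = {((u, v), (v, w)) | u v w. (u, v) \<in> parcs G \<and> (v, w) \<in> parcs G} \<rparr>"

lemma pair_wf_digraph_line_digraph: "pair_wf_digraph (line_digraph G)"
  by unfold_locales (auto simp: line_digraph_def)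

end

theory Submission
  imports Defs
begin

text \<open>
  A walk \<open>q\<close> of length \<open>k + 1\<close> in \<open>G\<close>, read as its list of arcs, is a walk of length \<open>k\<close> in
  \<open>L(G)\<close>. To join the arc \<open>(a, b)\<close> to the arc \<open>(c, d)\<close> in \<open>L(G)\<close>, extend the walk from \<open>b\<close> to
  \<open>c\<close> in \<open>W\<close> by \<open>a\<close> in front and by \<open>d\<close> at the end, and read the result as a list of arcs.
\<close>

lemma vwalk_arcs_extend:
  "p \<noteq> [] \<Longrightarrow> vwalk_arcs (a # p @ [d]) = (a, hd p) # vwalk_arcs p @ [(last p, d)]"
  by (simp add: vwalk_arcs_append)

lemma length_vwalk_arcs: "length (vwalk_arcs p) = length p - 1"
  by (simp flip: vwalk_length_def)

text \<open>Two consecutive arcs of a vertex list share their middle vertex, which is exactly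
  adjacency in \<open>line_digraph G\<close>. A pair of arcs needs three vertices, hence the case
  split on \<open>zs\<close>.\<close>

lemma set_vwalk_arcs_vwalk_arcs:
  "set (vwalk_arcs q) \<subseteq> parcs G \<Longrightarrow>
    set (vwalk_arcs (vwalk_arcs q)) \<subseteq> parcs (line_digraph G)"
proof (induction q rule: vwalk_arcs.induct)
  case (3 x y zs)
  then show ?case by (cases zs) (auto simp: line_digraph_def)
qed simp_all

text \<open>The arcs of the extended list lie in \<open>parcs G\<close>, so they are vertices of the
  line digraph; the previous lemma handles adjacency.\<close>

lemma vwalk_line_digraph_extend:
  assumes "vwalk p (with_proj G)" "(a, hd p) \<in> parcs G" "(last p, d) \<in> parcs G"
  shows "vwalk (vwalk_arcs (a # p @ [d])) (with_proj (line_digraph G))"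
proof -
  have "p \<noteq> []" and "set (vwalk_arcs p) \<subseteq> parcs G"
    using assms(1) by (auto simp: vwalk_def)
  then have ne: "vwalk_arcs (a # p @ [d]) \<noteq> []"
    and arcs: "set (vwalk_arcs (a # p @ [d])) \<subseteq> parcs G"
    using assms(2,3) by (auto simp: vwalk_arcs_extend simp del: vwalk_arcs_Cons)
  have "pverts (line_digraph G) = parcs G"
    by (simp add: line_digraph_def)
  with ne arcs set_vwalk_arcs_vwalk_arcs[OF arcs] show ?thesis
    unfolding vwalk_def with_proj_simps by blast
qed

theorem theorem3:
  fixes G :: "'a pair_pre_digraph" and W :: "'a vwalk set" and K :: "nat set"
  assumes "pair_wf_digraph G"
    and "walk_cover G W"
    and "K = {k. \<exists>p\<in>W. vwalk_length p = k}"
  shows "\<exists>W'. walk_cover (line_digraph G) W' \<and>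
           (\<forall>p\<in>W'. vwalk_length p \<in> {k + 1 | k. k \<in> K})"
proof -
  interpret pair_wf_digraph G by fact
  have walk: "vwalk p (with_proj G)" if "p \<in> W" for p
    using assms(2) that by (auto simp: walk_cover_def)
  then have ne: "p \<noteq> []" if "p \<in> W" for p
    using that by (auto simp: vwalk_def)
  have unique: "\<exists>!p. p \<in> W \<and> hd p = u \<and> last p = v"
    if "u \<in> pverts G" "v \<in> pverts G" for u v
    using assms(2) that by (simp add: walk_cover_def)
  define W' where "W' = {vwalk_arcs (a # p @ [d]) | a p d.
    p \<in> W \<and> (a, hd p) \<in> parcs G \<and> (last p, d) \<in> parcs G}"
  have ends: "hd (vwalk_arcs (a # p @ [d])) = (a, hd p)"
    "last (vwalk_arcs (a # p @ [d])) = (last p, d)" if "p \<in> W" for a p d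
    using ne[OF that] by (simp_all add: vwalk_arcs_extend del: vwalk_arcs_Cons)
  have "\<exists>!q. q \<in> W' \<and> hd q = e \<and> last q = f"
    if "e \<in> parcs G" "f \<in> parcs G" for e f
  proof -
    obtain a b c d where ef: "e = (a, b)" "f = (c, d)"
      by (cases e, cases f)
    \<comment> \<open>Well-formedness puts the ends of arcs among the vertices, so \<open>W\<close>
      joins \<open>b\<close> to \<open>c\<close>, also when \<open>b = c\<close>.\<close>
    have "b \<in> pverts G" "c \<in> pverts G"
      using that ef by (auto dest: in_arcsD1 in_arcsD2)
    from unique[OF this] obtain p where p: "p \<in> W" "hd p = b" "last p = c"
      and p_unique: "\<And>r. r \<in> W \<Longrightarrow> hd r = b \<Longrightarrow> last r = c \<Longrightarrow> r = p"
      by blast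
    show ?thesis
    proof (rule ex1I)
      have "vwalk_arcs (a # p @ [d]) \<in> W'"
        using p that ef unfolding W'_def by blast
      then show "vwalk_arcs (a # p @ [d]) \<in> W' \<and> hd (vwalk_arcs (a # p @ [d])) = e
          \<and> last (vwalk_arcs (a # p @ [d])) = f"
        using ends[OF p(1)] p ef by blast
    next
      fix q assume q: "q \<in> W' \<and> hd q = e \<and> last q = f"
      then obtain x r y where r: "q = vwalk_arcs (x # r @ [y])" "r \<in> W"
        unfolding W'_def by blast
      \<comment> \<open>The first and last arcs of \<open>q\<close> reveal \<open>x\<close>,
        \<open>y\<close> and both ends of \<open>r\<close>; uniqueness in \<open>W\<close> then
        forces \<open>r = p\<close>.\<close>
      have "(x, hd r) = (a, b)" "(last r, y) = (c, d)"
        using q ef r(1) ends[OF r(2), of x y] by metis+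
      then show "q = vwalk_arcs (a # p @ [d])"
        using r p_unique[of r] by blast
    qed
  qed
  moreover have "vwalk q (with_proj (line_digraph G))" if q: "q \<in> W'" for q
  proof -
    obtain a p d where "q = vwalk_arcs (a # p @ [d])" "p \<in> W"
      "(a, hd p) \<in> parcs G" "(last p, d) \<in> parcs G"
      using q unfolding W'_def by blast
    then show ?thesis
      using vwalk_line_digraph_extend walk by metis
  qed
  moreover have "pverts (line_digraph G) = parcs G"
    by (simp add: line_digraph_def)
  ultimately have "walk_cover (line_digraph G) W'"
    unfolding walk_cover_def by simp
  moreover have "vwalk_length q \<in> {k + 1 | k. k \<in> K}" if q: "q \<in> W'" for q
  proof -
    obtain a p d where q_eq: "q = vwalk_arcs (a # p @ [d])" and p: "p \<in> W"
      using q unfolding W'_def by blast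
    \<comment> \<open>If \<open>p\<close> has \<open>k + 1\<close> vertices, the extended list has
      \<open>k + 3\<close>, hence \<open>k + 2\<close> arcs, which form a walk of length
      \<open>k + 1\<close>. As \<open>p\<close> is nonempty, the truncated subtraction in the length
      is harmless.\<close>
    have "vwalk_length q = vwalk_length p + 1"
      using ne[OF p] unfolding q_eq by (cases p) (simp_all add: length_vwalk_arcs)
    then show ?thesis
      using p assms(3) by blast
  qed
  ultimately show ?thesis by blast
qed

end
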